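(* Let $K$ be an integer and $m,n>1$ integers, and assume either that $K$ is odd, or that $K$ is even and $m,n$ are both odd. Let $L=\mathrm{lcm}[m,n]$. Then: (a) if $\omega_K(m)=\omega_K(n)=1$, then $\omega_K(L)=1$; (b) if $\omega_K(m)=2$ or $\omega_K(n)=2$, then $\omega_K(L)=2$; (c) if $\omega_K(m)=\omega_K(n)=4$, then $\omega_K(L)=4$; (d) if one of $m,n$ has order $1$ and the other has order $4$, then $\omega_K(L)=4$ if the one of order $1$ equals $2$, and $\omega_K(L)=2$ otherwise.
   Context: For an integer $K$, the $K$-Fibonacci sequence is $F_{K,0}=0$, $F_{K,1}=1$, $F_{K,n}=KF_{K,n-1}+F_{K,n-2}$ for $n\ge2$. For an integer $m\ge 2$, $\pi_K(m)$ is the least positive period of $(F_{K,n}\bmod m)$ and $\omega_K(m)$ (the order of $m$) is the number of indices $0\le j<\pi_K(m)$ with $m\mid F_{K,j}$. *)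

theory Defs
  imports "HOL-Number_Theory.Cong"
begin

fun kfib :: "int \<Rightarrow> nat \<Rightarrow> int" where
  "kfib K 0 = 0"
| "kfib K (Suc 0) = 1"
| "kfib K (Suc (Suc n)) = K * kfib K (Suc n) + kfib K n"

(* The recurrence can be run backwards (the coefficient of the older term is 1),
   so for every m > 0 the sequence is purely periodic modulo m and the minimum is attained. *)
definition kfib_period :: "int \<Rightarrow> int \<Rightarrow> nat" where
  "kfib_period K m = (LEAST p. p > 0 \<and> (\<forall>i. [kfib K (i + p) = kfib K i] (mod m)))"

definition kfib_order :: "int \<Rightarrow> int \<Rightarrow> nat" where
  "kfib_order K m = card {j. j < kfib_period K m \<and> m dvd kfib K j}"

end

theory Submission
  imports Defs "HOL-Computational_Algebra.Primes"
begin

text \<open>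
  Let \<open>\<alpha>(m)\<close> be the least positive index of a term divisible by \<open>m\<close>. Then \<open>\<alpha>(m)\<close> divides
  \<open>\<pi>(m)\<close>, the quotient is \<open>\<omega>(m)\<close>, and \<open>\<omega>(m)\<close> is the multiplicative order modulo \<open>m\<close> of the term
  after \<open>F\<^bsub>\<alpha>(m)\<^esub>\<close>, whose square is \<open>(-1)\<^bsup>\<alpha>(m)\<^esup>\<close> by Cassini's identity. Hence \<open>\<omega>(m)\<close> is 1, 2 or 4.
  The parity hypothesis enters through a halving argument: \<open>4 dvd \<pi>(m)\<close> forces \<open>m dvd F\<^bsub>\<pi>(m)/2\<^esub>\<close>,
  so that \<open>\<alpha>(m) < \<pi>(m)\<close>.
  Consequently \<open>\<omega>(m) = 1\<close> iff \<open>\<pi>(m)\<close> is not divisible by 4, while in the other case \<open>\<omega>(m)\<close> is 2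
  or 4 according to the parity of \<open>\<alpha>(m)\<close>. Since \<open>\<alpha>\<close> and \<open>\<pi>\<close> both turn \<open>lcm\<close> into \<open>lcm\<close>, these two
  divisibility conditions can be read off for \<open>lcm m n\<close>.
\<close>

text \<open>Closure of \<open>P\<close> under shifts by its own members lets an index be reduced
  modulo the least positive member; minimality makes the remainder 0. Period and rank are both
  instances.\<close>

lemma Least_pos_dvd_iff:
  fixes P :: "nat \<Rightarrow> bool"
  assumes shift: "\<And>a j. P a \<Longrightarrow> P (j + a) \<longleftrightarrow> P j" and ex: "p > 0" "P p"
  shows "(LEAST p. p > 0 \<and> P p) > 0" "(LEAST p. p > 0 \<and> P p) dvd j \<longleftrightarrow> P j"
proof -
  define q where "q = (LEAST p. p > 0 \<and> P p)"
  have q: "q > 0" "P q"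
    using LeastI[of "\<lambda>p. p > 0 \<and> P p" p] ex by (auto simp: q_def)
  have min: "q \<le> i" if "i > 0" "P i" for i
    unfolding q_def using that by (simp add: Least_le)
  show "(LEAST p. p > 0 \<and> P p) > 0" using q by (simp add: q_def)
  have P0: "P 0" using shift[of p 0] ex by simp
  have mult: "P (i + c * q) \<longleftrightarrow> P i" for i c
  proof (induction c)
    case (Suc c)
    then show ?case using shift[OF q(2), of "i + c * q"] by (simp add: ac_simps)
  qed simp
  have "P j \<longleftrightarrow> P (j mod q)"
    using mult[of "j mod q" "j div q"] by simp
  also have "\<dots> \<longleftrightarrow> j mod q = 0"
    using min[of "j mod q"] q(1) mod_less_divisor[of q j] P0 by (metis leD neq0_conv)
  finally show "(LEAST p. p > 0 \<and> P p) dvd j \<longleftrightarrow> P j"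
    by (simp add: q_def dvd_eq_mod_eq_0)
qed

section \<open>Addition, Cassini and doubling identities\<close>

lemma kfib_add: "kfib K (Suc (i + j)) = kfib K (Suc i) * kfib K (Suc j) + kfib K i * kfib K j"
proof (induction i rule: induct_nat_012)
  case (ge2 i)
  have "kfib K (Suc (Suc (Suc i) + j)) = K * kfib K (Suc (Suc i + j)) + kfib K (Suc (i + j))"
    by simp
  also have "\<dots> = K * (kfib K (Suc (Suc i)) * kfib K (Suc j) + kfib K (Suc i) * kfib K j)
      + (kfib K (Suc i) * kfib K (Suc j) + kfib K i * kfib K j)"
    by (simp only: ge2)
  finally show ?case by (simp add: algebra_simps)
qed simp_all

text \<open>With the third term eliminated by the recurrence, Cassini's identity concerns a
  quadratic form in two consecutive terms, which changes sign at each step.\<close>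

lemma kfib_cassini:
  "(kfib K (Suc n))\<^sup>2 - K * kfib K n * kfib K (Suc n) - (kfib K n)\<^sup>2 = (-1) ^ n"
proof (induction n)
  case (Suc n)
  have "(kfib K (Suc (Suc n)))\<^sup>2 - K * kfib K (Suc n) * kfib K (Suc (Suc n)) - (kfib K (Suc n))\<^sup>2
      = - ((kfib K (Suc n))\<^sup>2 - K * kfib K n * kfib K (Suc n) - (kfib K n)\<^sup>2)"
    by (simp add: power2_eq_square algebra_simps)
  then show ?case by (simp only: Suc power_Suc)
qed simp

lemma kfib_double:
  "kfib K (2 * k) = kfib K k * (2 * kfib K (Suc k) - K * kfib K k)"
  "kfib K (Suc (2 * k)) = (kfib K (Suc k))\<^sup>2 + (kfib K k)\<^sup>2"
proof -
  show eq: "kfib K (Suc (2 * k)) = (kfib K (Suc k))\<^sup>2 + (kfib K k)\<^sup>2" for k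
    using kfib_add[of K k k] by (simp add: power2_eq_square mult_2)
  \<comment> \<open>The addition formula reaches index \<open>2 * k + 2\<close>; removing
    \<open>K\<close> times the preceding term leaves the one at \<open>2 * k\<close>.\<close>
  have "K * kfib K (Suc (2 * k)) + kfib K (2 * k)
      = kfib K (Suc k) * (K * kfib K (Suc k) + kfib K k) + kfib K k * kfib K (Suc k)"
    using kfib_add[of K k "Suc k"] by (simp add: mult_2)
  then show "kfib K (2 * k) = kfib K k * (2 * kfib K (Suc k) - K * kfib K k)"
    unfolding eq by algebra
qed

section \<open>Shifts by the index of a term divisible by the modulus\<close>

text \<open>From index \<open>a\<close> on, the sequence modulo \<open>m\<close> starts with 0 and
  \<open>kfib K (Suc a)\<close>; by linearity it is the original sequence scaled by this
  multiplier.\<close>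

lemma kfib_shift_cong:
  assumes "m dvd kfib K a"
  shows "[kfib K (i + a) = kfib K (Suc a) * kfib K i] (mod m)"
proof (induction i rule: induct_nat_012)
  case 0
  then show ?case using assms by (simp add: cong_0_iff)
next
  case 1
  then show ?case by simp
next
  case (ge2 i)
  have "[K * kfib K (Suc i + a) + kfib K (i + a)
      = K * (kfib K (Suc a) * kfib K (Suc i)) + kfib K (Suc a) * kfib K i] (mod m)"
    using ge2 by (intro cong_add cong_mult cong_refl) auto
  then show ?case by (simp add: algebra_simps)
qed

lemma kfib_shift_mult_cong:
  assumes "m dvd kfib K a"
  shows "[kfib K (i + a * k) = kfib K (Suc a) ^ k * kfib K i] (mod m)"
proof (induction k)
  case (Suc k)
  have "[kfib K (i + a * k + a) = kfib K (Suc a) * kfib K (i + a * k)] (mod m)"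
    by (rule kfib_shift_cong[OF assms])
  moreover have "[kfib K (Suc a) * kfib K (i + a * k)
      = kfib K (Suc a) * (kfib K (Suc a) ^ k * kfib K i)] (mod m)"
    using Suc by (intro cong_mult cong_refl)
  ultimately have "[kfib K (i + a * k + a)
      = kfib K (Suc a) * (kfib K (Suc a) ^ k * kfib K i)] (mod m)"
    by (rule cong_trans)
  then show ?case by (simp add: algebra_simps)
qed simp

text \<open>Cassini's identity at \<open>a\<close>, where the terms containing
  \<open>kfib K a\<close> vanish modulo \<open>m\<close>.\<close>

lemma kfib_multiplier_square:
  assumes "m dvd kfib K a"
  shows "[(kfib K (Suc a))\<^sup>2 = (-1) ^ a] (mod m)"
proof -
  have "(kfib K (Suc a))\<^sup>2 - (-1) ^ a = kfib K a * (K * kfib K (Suc a) + kfib K a)"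
    using kfib_cassini[of K a] by (simp add: power2_eq_square algebra_simps)
  then show ?thesis using assms by (simp add: cong_iff_dvd_diff)
qed

lemma kfib_multiplier_coprime:
  assumes "m dvd kfib K a"
  shows "coprime m (kfib K (Suc a))"
proof -
  have "coprime ((-1) ^ a) m" by simp
  then have "coprime ((kfib K (Suc a))\<^sup>2) m"
    using cong_imp_coprime[OF cong_sym[OF kfib_multiplier_square[OF assms]]] by blast
  then show ?thesis by (simp add: coprime_commute)
qed

section \<open>Period and rank of apparition\<close>

lemma kfib_period_iff:
  "(\<forall>i. [kfib K (i + p) = kfib K i] (mod m)) \<longleftrightarrow>
     m dvd kfib K p \<and> [kfib K (Suc p) = 1] (mod m)" (is "?L \<longleftrightarrow> ?R")
proof
  assume L: ?L
  show ?R using L[rule_format, of 0] L[rule_format, of 1] by (simp add: cong_0_iff)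
next
  assume R: ?R
  show ?L
  proof
    fix i
    have "[kfib K (i + p) = kfib K (Suc p) * kfib K i] (mod m)"
      using R by (intro kfib_shift_cong) simp
    moreover have "[kfib K (Suc p) * kfib K i = 1 * kfib K i] (mod m)"
      using R by (intro cong_mult cong_refl) simp
    ultimately show "[kfib K (i + p) = kfib K i] (mod m)"
      by (metis cong_trans mult_1)
  qed
qed

text \<open>The older term has coefficient 1 in the recurrence, so agreement of two consecutive
  terms descends to index 0.\<close>

lemma kfib_backwards_cong:
  assumes "[kfib K (i + d) = kfib K i] (mod m)" "[kfib K (Suc i + d) = kfib K (Suc i)] (mod m)"
  shows "m dvd kfib K d \<and> [kfib K (Suc d) = 1] (mod m)"
  using assms
proof (induction i)
  case 0
  then show ?case by (simp add: cong_0_iff)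
next
  case (Suc i)
  have "[kfib K (Suc (Suc (i + d))) - K * kfib K (Suc (i + d))
      = kfib K (Suc (Suc i)) - K * kfib K (Suc i)] (mod m)"
    using Suc.prems by (intro cong_diff cong_mult cong_refl) simp_all
  then show ?case using Suc by simp
qed

text \<open>Pigeonhole on the finitely many residue pairs of consecutive terms; a repeated pair is
  carried back to the start.\<close>

lemma kfib_period_exists:
  assumes "m > 0"
  shows "\<exists>p>0. \<forall>i. [kfib K (i + p) = kfib K i] (mod m)"
proof -
  define f where "f i = (kfib K i mod m, kfib K (Suc i) mod m)" for i
  have "range f \<subseteq> {0..<m} \<times> {0..<m}"
    using assms by (auto simp: f_def)
  then have "finite (range f)" by (rule finite_subset) simp
  then have "\<not> inj f" using finite_imageD infinite_UNIV_nat by blast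
  then obtain i j where "f i = f j" "i < j"
    by (metis injI linorder_neqE_nat)
  then have "[kfib K (i + (j - i)) = kfib K i] (mod m)"
    "[kfib K (Suc i + (j - i)) = kfib K (Suc i)] (mod m)" "j - i > 0"
    by (simp_all add: f_def cong_def)
  then show ?thesis using kfib_backwards_cong kfib_period_iff by blast
qed

lemma kfib_period:
  assumes "m > 0"
  shows kfib_period_pos: "kfib_period K m > 0"
    and kfib_period_dvd_iff: "kfib_period K m dvd j \<longleftrightarrow>
      m dvd kfib K j \<and> [kfib K (Suc j) = 1] (mod m)"
proof -
  let ?P = "\<lambda>p. \<forall>i. [kfib K (i + p) = kfib K i] (mod m)"
  have shift: "?P (j + a) \<longleftrightarrow> ?P j" if "?P a" for a j
  proof -
    have "[kfib K (i + (j + a)) = kfib K (i + j)] (mod m)" for i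
      using that[rule_format, of "i + j"] by (simp add: add.assoc)
    then show ?thesis by (meson cong_sym cong_trans)
  qed
  obtain p where "p > 0" "?P p" using kfib_period_exists[OF assms] by blast
  from Least_pos_dvd_iff[of ?P, OF shift this]
  show "kfib_period K m > 0" "kfib_period K m dvd j \<longleftrightarrow>
      m dvd kfib K j \<and> [kfib K (Suc j) = 1] (mod m)"
    unfolding kfib_period_def kfib_period_iff by blast+
qed

definition kfib_rank :: "int \<Rightarrow> int \<Rightarrow> nat" where
  "kfib_rank K m = (LEAST a. a > 0 \<and> m dvd kfib K a)"

text \<open>Shifting by the index of a divisible term multiplies by a unit modulo \<open>m\<close>
  and so preserves divisibility; the period supplies a positive index.\<close>

lemma kfib_rank:
  assumes "m > 0"
  shows kfib_rank_pos: "kfib_rank K m > 0"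
    and kfib_rank_dvd_iff: "kfib_rank K m dvd j \<longleftrightarrow> m dvd kfib K j"
proof -
  have shift: "m dvd kfib K (j + a) \<longleftrightarrow> m dvd kfib K j" if "m dvd kfib K a" for a j
    using cong_dvd_iff[OF kfib_shift_cong[OF that, of j]] kfib_multiplier_coprime[OF that]
    by (simp add: coprime_dvd_mult_right_iff)
  have "m dvd kfib K (kfib_period K m)"
    using kfib_period_dvd_iff[OF assms, of K "kfib_period K m"] by simp
  from Least_pos_dvd_iff[of "\<lambda>a. m dvd kfib K a", OF shift kfib_period_pos[OF assms] this]
  show "kfib_rank K m > 0" "kfib_rank K m dvd j \<longleftrightarrow> m dvd kfib K j"
    unfolding kfib_rank_def by blast+
qed

lemma dvd_kfib_rank: "m > 0 \<Longrightarrow> m dvd kfib K (kfib_rank K m)"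
  using kfib_rank_dvd_iff[of m K "kfib_rank K m"] by simp

section \<open>The order as multiplicative order of the multiplier\<close>

lemma kfib_period_eq_rank_mult_order:
  assumes "m > 0"
  shows "kfib_period K m = kfib_rank K m * kfib_order K m"
proof -
  let ?A = "kfib_rank K m"
  have "?A dvd kfib_period K m"
    using kfib_period_dvd_iff[OF assms, of K "kfib_period K m"] kfib_rank_dvd_iff[OF assms]
    by simp
  then obtain k where k: "kfib_period K m = ?A * k" ..
  have "{j. j < kfib_period K m \<and> m dvd kfib K j} = (\<lambda>i. ?A * i) ` {..<k}"
    using kfib_rank_pos[OF assms, of K] by (auto simp: k kfib_rank_dvd_iff[OF assms, symmetric])
  then have "kfib_order K m = k"
    using kfib_rank_pos[OF assms, of K]
    by (simp add: kfib_order_def card_image inj_on_def)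
  then show ?thesis using k by simp
qed

text \<open>Shifting \<open>k\<close> times by the rank multiplies by the \<open>k\<close>-th power
  of the multiplier, so the initial pair 0, 1 recurs exactly when that power is 1.\<close>

lemma kfib_order_dvd_iff:
  assumes "m > 0"
  shows "kfib_order K m dvd k \<longleftrightarrow> [kfib K (Suc (kfib_rank K m)) ^ k = 1] (mod m)"
proof -
  let ?A = "kfib_rank K m"
  have "kfib_order K m dvd k \<longleftrightarrow> kfib_period K m dvd ?A * k"
    using kfib_rank_pos[OF assms, of K] by (simp add: kfib_period_eq_rank_mult_order[OF assms])
  also have "\<dots> \<longleftrightarrow> [kfib K (Suc (?A * k)) = 1] (mod m)"
    using kfib_rank_dvd_iff[OF assms, of K "?A * k"] by (simp add: kfib_period_dvd_iff[OF assms])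
  also have "\<dots> \<longleftrightarrow> [kfib K (Suc ?A) ^ k = 1] (mod m)"
    using kfib_shift_mult_cong[OF dvd_kfib_rank[OF assms, of K], of 1 k]
    by (auto intro: cong_trans cong_sym)
  finally show ?thesis .
qed

text \<open>The squared multiplier is \<open>(-1) ^ kfib_rank K m\<close> modulo \<open>m\<close>,
  and \<open>m > 2\<close> keeps -1 and 1 apart.\<close>

lemma kfib_order_dvd_2_iff:
  assumes "m > 2"
  shows "kfib_order K m dvd 2 \<longleftrightarrow> even (kfib_rank K m)"
proof -
  have "[(-1) ^ a = 1] (mod m) \<longleftrightarrow> even a" for a :: nat
    using assms zdvd_not_zless[of 2 m] by (cases "even a") (auto simp: cong_iff_dvd_diff)
  then show ?thesis
    using kfib_order_dvd_iff[of m K 2] kfib_multiplier_square[OF dvd_kfib_rank[of m K]] assms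
    by (auto intro: cong_trans cong_sym)
qed

lemma kfib_order_dvd_4:
  assumes "m > 0"
  shows "kfib_order K m dvd 4"
proof -
  let ?s = "kfib K (Suc (kfib_rank K m))"
  have "[(?s\<^sup>2)\<^sup>2 = ((-1) ^ kfib_rank K m)\<^sup>2] (mod m)"
    by (intro cong_pow kfib_multiplier_square dvd_kfib_rank assms)
  then have "[?s ^ 4 = 1] (mod m)"
    by (simp flip: power_mult add: power_even_eq)
  then show ?thesis using kfib_order_dvd_iff[OF assms] by blast
qed

lemma kfib_order_cases:
  assumes "m > 0"
  shows "kfib_order K m = 1 \<or> kfib_order K m = 2 \<or> kfib_order K m = 4"
proof -
  have "k = 1 \<or> k = 2 \<or> k = 4" if "k dvd 4" for k :: nat
  proof -
    have "k \<le> 4" using that by (simp add: dvd_imp_le)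
    then consider "k = 0" | "k = 1" | "k = 2" | "k = 3" | "k = 4" by linarith
    then show ?thesis using that by cases auto
  qed
  then show ?thesis using kfib_order_dvd_4[OF assms] by blast
qed

section \<open>Halving the period, and the modulus 2\<close>

text \<open>As \<open>p div 2\<close> is even, Cassini's form equals 1 there. Together with the
  doubling formulas this shows that \<open>m\<close> divides both 2 and \<open>K\<close> times the
  middle term; an odd \<open>m\<close> or an odd \<open>K\<close> then removes the factor.\<close>

lemma kfib_period_half:
  assumes "4 dvd p" "m dvd kfib K p" "[kfib K (Suc p) = 1] (mod m)" "odd K \<or> odd m"
  shows "m dvd kfib K (p div 2)"
proof -
  obtain t where "p = 4 * t" using assms(1) ..
  then have t: "p = 2 * (2 * t)" by simp
  define x y where "x = kfib K (2 * t)" and "y = kfib K (Suc (2 * t))"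
  have cassini: "y\<^sup>2 - K * x * y - x\<^sup>2 = 1"
    using kfib_cassini[of K "2 * t"] by (simp add: x_def y_def)
  have 1: "m dvd x * (2 * y - K * x)"
    using assms(2) unfolding t kfib_double(1)[of K "2 * t"] x_def y_def .
  have "m dvd y\<^sup>2 + x\<^sup>2 - 1"
    using assms(3) unfolding t kfib_double(2)[of K "2 * t"] x_def y_def cong_iff_dvd_diff .
  moreover have "y\<^sup>2 + x\<^sup>2 - 1 = x * (2 * x + K * y)"
    using cassini by algebra
  ultimately have 2: "m dvd x * (2 * x + K * y)" by simp
  \<comment> \<open>The multipliers \<open>y\<close> and \<open>x\<close> are chosen so that the
    Cassini form, equal to 1, splits off; the combination further below does the same with factor
    \<open>K\<close>.\<close>
  have "m dvd x * (2 * y - K * x) * y - x * (2 * x + K * y) * x"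
    by (rule dvd_diff[OF dvd_mult2[OF 1] dvd_mult2[OF 2]])
  also have "\<dots> = 2 * x * (y\<^sup>2 - K * x * y - x\<^sup>2)"
    by (simp add: power2_eq_square algebra_simps)
  finally have twice: "m dvd 2 * x" by (simp add: cassini)
  have "m dvd x * (2 * x + K * y) * (y - K * x) - x * (2 * y - K * x) * x"
    by (rule dvd_diff[OF dvd_mult2[OF 2] dvd_mult2[OF 1]])
  also have "\<dots> = K * x * (y\<^sup>2 - K * x * y - x\<^sup>2)"
    by (simp add: power2_eq_square algebra_simps)
  finally have Kx: "m dvd K * x" by (simp add: cassini)
  have "m dvd x"
  proof (cases "odd m")
    case True
    then show ?thesis using twice by (simp add: coprime_dvd_mult_right_iff)
  next
    case False
    then have "odd K" using assms(4) by simp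
    then obtain c where "K = 2 * c + 1" by (rule oddE)
    then have "K * x - c * (2 * x) = x" by (simp add: algebra_simps)
    then show ?thesis using dvd_diff[OF Kx dvd_mult[OF twice, of c]] by (simp only:)
  qed
  then show ?thesis by (simp add: x_def t)
qed

lemma kfib_rank_2:
  assumes "odd K"
  shows "kfib_rank K 2 = 3"
proof -
  have "kfib K 3 = K * K + 1" by (simp add: numeral_3_eq_3)
  then have "kfib_rank K 2 dvd 3" "kfib_rank K 2 \<noteq> 1"
    using assms kfib_rank_dvd_iff[of 2 K 3] kfib_rank_dvd_iff[of 2 K 1] by auto
  moreover have "prime (3::nat)" by simp
  ultimately show ?thesis by (metis prime_nat_iff)
qed

lemma kfib_order_2: "kfib_order K 2 = 1"
proof -
  have "coprime 2 (kfib K (Suc (kfib_rank K 2)))"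
    by (intro kfib_multiplier_coprime dvd_kfib_rank) simp
  then have "[kfib K (Suc (kfib_rank K 2)) ^ 1 = 1] (mod 2)"
    by (simp add: cong_iff_dvd_diff)
  then show ?thesis using kfib_order_dvd_iff[of 2 K 1] by simp
qed

text \<open>Source of the exceptional modulus 2 in case (d): its rank is 3, whereas order 1 forces
  an even rank for every larger modulus.\<close>

lemma even_kfib_rank_iff:
  assumes "m > 1" "odd K \<or> odd m" "kfib_order K m = 1"
  shows "even (kfib_rank K m) \<longleftrightarrow> m \<noteq> 2"
proof (cases "m = 2")
  case True
  then show ?thesis using assms by (simp add: kfib_rank_2)
next
  case False
  then show ?thesis using assms kfib_order_dvd_2_iff[of m K] by simp
qed

section \<open>Reading the order off period and rank\<close>

text \<open>Under order 1 the rank equals the period, so halving a period divisible by 4 would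
  contradict minimality of the rank. Conversely, order 2 comes with an even rank, so orders 2 and 4
  both put a factor 4 into the period.\<close>

lemma kfib_order_eq_1_iff:
  assumes "m > 1" "odd K \<or> odd m"
  shows "kfib_order K m = 1 \<longleftrightarrow> \<not> 4 dvd kfib_period K m"
proof -
  let ?A = "kfib_rank K m"
  have P: "kfib_period K m = ?A * kfib_order K m"
    using assms by (simp add: kfib_period_eq_rank_mult_order)
  show ?thesis
  proof
    assume 1: "kfib_order K m = 1"
    show "\<not> 4 dvd kfib_period K m"
    proof
      assume dvd: "4 dvd kfib_period K m"
      then have "m dvd kfib K (kfib_period K m div 2)"
        using assms kfib_period_dvd_iff[of m K "kfib_period K m"]
        by (intro kfib_period_half) auto
      then have "?A dvd ?A div 2"
        using assms P 1 by (simp add: kfib_rank_dvd_iff)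
      moreover have "?A div 2 > 0" "?A div 2 < ?A"
        using dvd P 1 assms kfib_rank_pos[of m K] by (auto simp: dvd_imp_le)
      ultimately show False by (auto dest: dvd_imp_le)
    qed
  next
    assume ndvd: "\<not> 4 dvd kfib_period K m"
    show "kfib_order K m = 1"
    proof (rule ccontr)
      assume "kfib_order K m \<noteq> 1"
      then have 2: "kfib_order K m = 2"
        using kfib_order_cases[of m K] assms(1) ndvd P by auto
      have "m > 2" using 2 kfib_order_2[of K] assms by (cases "m = 2") auto
      then have "even ?A" using 2 kfib_order_dvd_2_iff[of m K] by simp
      then have "2 * 2 dvd ?A * 2" by (intro mult_dvd_mono) auto
      then show False using ndvd P 2 by simp
    qed
  qed
qed

lemma kfib_order_eq_2_iff:
  assumes "m > 1" "odd K \<or> odd m"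
  shows "kfib_order K m = 2 \<longleftrightarrow> 4 dvd kfib_period K m \<and> even (kfib_rank K m)"
proof (cases "m = 2")
  case True
  then show ?thesis using kfib_order_2[of K] kfib_order_eq_1_iff[OF assms] by auto
next
  case False
  then have "m > 2" using assms by simp
  then show ?thesis
    using kfib_order_eq_1_iff[OF assms] kfib_order_dvd_2_iff[of m K]
      kfib_order_cases[of m K]
    by auto
qed

lemma kfib_order_eq_4_iff:
  assumes "m > 1" "odd K \<or> odd m"
  shows "kfib_order K m = 4 \<longleftrightarrow> 4 dvd kfib_period K m \<and> odd (kfib_rank K m)"
  using kfib_order_eq_1_iff[OF assms] kfib_order_eq_2_iff[OF assms]
    kfib_order_cases[of m K] assms(1)
  by auto

section \<open>Least common multiples\<close>

lemma kfib_rank_lcm: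
  assumes "m > 0" "n > 0"
  shows "kfib_rank K (lcm m n) = lcm (kfib_rank K m) (kfib_rank K n)"
proof -
  have "kfib_rank K (lcm m n) dvd j \<longleftrightarrow> lcm (kfib_rank K m) (kfib_rank K n) dvd j" for j
    using assms by (simp add: kfib_rank_dvd_iff lcm_pos_int)
  then show ?thesis by (meson dvd_antisym dvd_refl)
qed

lemma kfib_period_lcm:
  assumes "m > 0" "n > 0"
  shows "kfib_period K (lcm m n) = lcm (kfib_period K m) (kfib_period K n)"
proof -
  have "kfib_period K (lcm m n) dvd j \<longleftrightarrow> lcm (kfib_period K m) (kfib_period K n) dvd j" for j
    using assms by (auto simp add: kfib_period_dvd_iff lcm_pos_int cong_iff_dvd_diff)
  then show ?thesis by (meson dvd_antisym dvd_refl)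
qed

text \<open>The multiplicity of \<open>p\<close> in the lcm is the maximum of the two
  multiplicities.\<close>

lemma prime_power_dvd_lcm_iff:
  fixes a b p :: nat
  assumes "prime p" "a > 0" "b > 0"
  shows "p ^ k dvd lcm a b \<longleftrightarrow> p ^ k dvd a \<or> p ^ k dvd b"
proof -
  have "p ^ k dvd x \<longleftrightarrow> k \<le> multiplicity p x" if "x > 0" for x
    using that assms(1) by (intro power_dvd_iff_le_multiplicity finite_divisor_powers) auto
  then show ?thesis
    using assms by (simp add: multiplicity_lcm le_max_iff_disj lcm_pos_nat)
qed

theorem theorem4p27:
  fixes K m n :: int
  assumes "m > 1" and "n > 1"
    and "odd K \<or> (even K \<and> odd m \<and> odd n)"
  shows "(kfib_order K m = 1 \<and> kfib_order K n = 1 \<longrightarrow> kfib_order K (lcm m n) = 1)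
    \<and> (kfib_order K m = 2 \<or> kfib_order K n = 2 \<longrightarrow> kfib_order K (lcm m n) = 2)
    \<and> (kfib_order K m = 4 \<and> kfib_order K n = 4 \<longrightarrow> kfib_order K (lcm m n) = 4)
    \<and> (kfib_order K m = 1 \<and> kfib_order K n = 4 \<longrightarrow>
         kfib_order K (lcm m n) = (if m = 2 then 4 else 2))
    \<and> (kfib_order K m = 4 \<and> kfib_order K n = 1 \<longrightarrow>
         kfib_order K (lcm m n) = (if n = 2 then 4 else 2))"
proof -
  have m: "odd K \<or> odd m" and n: "odd K \<or> odd n" and pos: "m > 0" "n > 0"
    using assms by auto
  have L: "lcm m n > 1" "odd K \<or> odd (lcm m n)"
  proof -
    have "m \<le> lcm m n" using pos by (intro zdvd_imp_le) (auto simp: lcm_pos_int)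
    then show "lcm m n > 1" using assms by simp
    \<comment> \<open>The lcm divides \<open>m * n\<close>, which is odd when both factors
      are.\<close>
    show "odd K \<or> odd (lcm m n)"
      using assms(3) dvd_trans[of 2 "lcm m n" "m * n"] by (auto simp: lcm_least)
  qed
  have P: "4 dvd kfib_period K (lcm m n) \<longleftrightarrow> 4 dvd kfib_period K m \<or> 4 dvd kfib_period K n"
    using prime_power_dvd_lcm_iff[of 2 "kfib_period K m" "kfib_period K n" 2]
    by (simp add: kfib_period_lcm pos kfib_period_pos)
  have A: "even (kfib_rank K (lcm m n)) \<longleftrightarrow> even (kfib_rank K m) \<or> even (kfib_rank K n)"
    using prime_power_dvd_lcm_iff[of 2 "kfib_rank K m" "kfib_rank K n" 1]
    by (simp add: kfib_rank_lcm pos kfib_rank_pos)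
  note m_iffs = kfib_order_eq_1_iff[OF assms(1) m] kfib_order_eq_2_iff[OF assms(1) m]
    kfib_order_eq_4_iff[OF assms(1) m]
  note n_iffs = kfib_order_eq_1_iff[OF assms(2) n] kfib_order_eq_2_iff[OF assms(2) n]
    kfib_order_eq_4_iff[OF assms(2) n]
  note L_iffs = kfib_order_eq_1_iff[OF L] kfib_order_eq_2_iff[OF L] kfib_order_eq_4_iff[OF L]
  \<comment> \<open>Only propositional reasoning remains. In case (d) the modulus of order 4
    supplies the factor 4 of the period but has odd rank, so the modulus of order 1 decides the
    parity of the rank of the lcm.\<close>
  show ?thesis
    using m_iffs n_iffs L_iffs P A even_kfib_rank_iff[OF assms(1) m] even_kfib_rank_iff[OF assms(2) n]
    by auto
qed

end
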